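(* (1) For any $\epsilon >0$, there exists a compact subset of $\mathbb{R}^3$ of Lebesgue measure zero containing a horizontal unit line segment in every direction in $S^2 \setminus \mathcal{N}_{\epsilon}(\{(0,0,\pm 1)\})$. (2) There exists a closed subset of $\mathbb{R}^3$ of Lebesgue measure zero containing a horizontal unit line segment in every direction in $S^2 \setminus \{(0,0,\pm 1)\}$. (3) There exists a closed subset of $\mathbb{R}^3$ of Lebesgue measure zero containing a horizontal line in every direction in $S^2 \setminus \{(0,0,\pm 1)\}$. Moreover, (1), (2) and (3) all hold if "a horizontal" is replaced by "an $SL_2$".
   Context: The Heisenberg product on $\mathbb{R}^3$ is \[ (x_1,y_1,t_1) \ast (x_2,y_2,t_2) = \left(x_1+x_2,\; y_1+y_2,\; t_1 + t_2 + \tfrac{1}{2} ( x_1 y_2 - x_2 y_1 ) \right). \] A line $\ell \subseteq \mathbb{R}^3$ is called horizontal if there exist $\theta \in [0, \pi)$ and $p \in \mathbb{R}^3$ such that $\ell = p \ast \mathbb{V}_{\theta}$, where $\mathbb{V}_{\theta} = \{ (\lambda \cos\theta, \lambda\sin\theta, 0 ) : \lambda \in \mathbb{R} \}$. A line $\ell \subseteq \mathbb{R}^3$ is called an $SL_2$ line if either there exist $a,b,c,d \in \mathbb{R}$ with $ad-bc = 1$ such that $\ell = \{(a,b,0) + \lambda (c,d,1) : \lambda \in \mathbb{R} \}$, or there exist $t_0 \in \mathbb{R}$ and $(c,d) \in \mathbb{R}^2 \setminus \{0\}$ such that $\ell = \{(0,0,t_0) + \lambda (c,d,0) : \lambda \in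 \mathbb{R} \}$. Horizontal (respectively $SL_2$) unit line segments are line segments of Euclidean length $1$ contained in horizontal (respectively $SL_2$) lines. $\mathcal{N}_\epsilon(X)$ denotes the $\epsilon$-neighbourhood of the set $X$. *)

theory Defs
  imports "HOL-Analysis.Analysis"
begin

(* The norm, metric and Lebesgue measure on nested pairs of reals are the Euclidean ones,
   so this type is a model of Euclidean 3-space with coordinates (x, y, t). *)
type_synonym R3 = "real \<times> real \<times> real"

fun heis_mult :: "R3 \<Rightarrow> R3 \<Rightarrow> R3" (infixl "\<star>" 70) where
  "(x1, y1, t1) \<star> (x2, y2, t2) = (x1 + x2, y1 + y2, t1 + t2 + (1 / 2) * (x1 * y2 - x2 * y1))"

definition V :: "real \<Rightarrow> R3 set" where
  "V \<theta> = {(r * cos \<theta>, r * sin \<theta>, 0) | r. r \<in> UNIV}"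

definition horizontal_line :: "R3 set \<Rightarrow> bool" where
  "horizontal_line l \<longleftrightarrow> (\<exists>\<theta>\<in>{0..<pi}. \<exists>p. l = (\<lambda>q. p \<star> q) ` V \<theta>)"

definition SL2_line :: "R3 set \<Rightarrow> bool" where
  "SL2_line l \<longleftrightarrow>
     (\<exists>a b c d. a * d - b * c = 1 \<and> l = {(a, b, 0) + r *\<^sub>R (c, d, 1) | r. r \<in> UNIV}) \<or>
     (\<exists>t0 c d. (c, d) \<noteq> (0, 0) \<and> l = {(0, 0, t0) + r *\<^sub>R (c, d, 0) | r. r \<in> UNIV})"

(* Applied with horizontal_line or SL2_line for the family of lines. *)
definition unit_segment_of :: "(R3 set \<Rightarrow> bool) \<Rightarrow> R3 set \<Rightarrow> bool" where
  "unit_segment_of is_special S \<longleftrightarrow>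
     (\<exists>p q. S = closed_segment p q \<and> dist p q = 1) \<and> (\<exists>l. is_special l \<and> S \<subseteq> l)"

(* Meant for lines and nondegenerate segments; v and -v are directions of the same sets. *)
definition has_direction :: "R3 set \<Rightarrow> R3 \<Rightarrow> bool" where
  "has_direction S v \<longleftrightarrow> v \<noteq> 0 \<and> (\<forall>p\<in>S. \<forall>q\<in>S. q - p \<in> span {v})"

definition nbhd :: "real \<Rightarrow> R3 set \<Rightarrow> R3 set" where
  "nbhd \<epsilon> X = (\<Union>x\<in>X. ball x \<epsilon>)"

definition poles :: "R3 set" where
  "poles = {(0, 0, 1), (0, 0, -1)}"

end

(* A line through p with direction v is horizontal, up to the vertical ones, exactly when
   p1 v2 - p2 v1 = 2 v3, and an SL2 line exactly when p1 v2 - p2 v1 = v3; so both families are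
   treated together as the lines with p1 v2 - p2 v1 = \<kappa> v3.  Such a line of horizontal slope
   m satisfies \<kappa> t + x y = c + m x^2 for a constant c, and both m and v3/v1 can still be
   prescribed if c is chosen as a function of m alone.  The union of these lines over (m, c) in
   a compact planar set G therefore has the vertical sections {c + m w} (with w = x^2) up to an
   affine map, and one needs G to project onto [-1, 1] in the m-direction while all its
   projections (m, c) |-> c + m w are null.  Such a G is the closure of the graph of a function
   obtained by iterated Venetian blinds: the n-th stage is piecewise linear of slope
   \<sigma> n - \<sigma> 0, where \<sigma> is a dense sequence, so each w is nearly cancelled by
   infinitely many stages.  Directions with |v2| > |v1| are covered by the symmetry
   (x, y, t) |-> (y, x, -t). *)

theory Submission
  imports Defs
begin

section \<open>Slopes that recur near every real number\<close>

text \<open>Every interval holds infinitely many rationals, so an enumeration of them enters it at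
  arbitrarily late indices. Late indices matter because the tail of the construction must be small
  at the stage whose slope is right.\<close>

lemma exists_recurrent_dense_sequence:
  obtains q :: "nat \<Rightarrow> real" where "\<And>w e n. 0 < e \<Longrightarrow> \<exists>k\<ge>n. \<bar>q k - w\<bar> < e"
proof -
  define q :: "nat \<Rightarrow> real" where "q = from_nat_into \<rat>"
  have range_q: "range q = \<rat>"
    unfolding q_def by (rule range_from_nat_into) (use countable_rat Rats_0 in auto)
  have "\<exists>k\<ge>n. \<bar>q k - w\<bar> < e" if "0 < e" for w e n
  proof -
    have "infinite ({w - e<..<w + e} \<inter> \<rat>)"
    proof
      assume fin: "finite ({w - e<..<w + e} \<inter> \<rat>)"
      \<comment> \<open>A finite intersection would be closed, and density of the rationals would
        put the whole interval inside it.\<close>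
      have "{w - e<..<w + e} \<subseteq> closure ({w - e<..<w + e} \<inter> \<rat>)"
        using open_Int_closure_subset[of "{w - e<..<w + e}" "\<rat>"]
        by (simp add: Rats_closure_real)
      then have "finite {w - e<..<w + e}"
        using fin by (metis closure_closed finite_imp_closed finite_subset)
      then show False using that infinite_Ioo[of "w - e" "w + e"] by simp
    qed
    moreover have "{w - e<..<w + e} \<inter> \<rat> \<subseteq> q ` {k. \<bar>q k - w\<bar> < e}"
    proof
      fix r assume r: "r \<in> {w - e<..<w + e} \<inter> \<rat>"
      then obtain k where "r = q k" using range_q by blast
      then show "r \<in> q ` {k. \<bar>q k - w\<bar> < e}" using r by auto
    qed
    ultimately have "infinite {k. \<bar>q k - w\<bar> < e}"
      by (meson finite_imageI finite_subset)
    then show ?thesis by (metis (mono_tags) infinite_nat_iff_unbounded_le mem_Collect_eq)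
  qed
  then show thesis using that by blast
qed

section \<open>The iterated Venetian blind function\<close>

text \<open>
  The \<open>n\<close>-th stage of the Venetian blind construction is \<open>\<Sum>k<n. blind_term \<sigma> k\<close>: adding
  \<open>blind_term \<sigma> k\<close> tilts every piece from slope \<open>\<sigma> k - \<sigma> 0\<close> to \<open>\<sigma> (k + 1) - \<sigma> 0\<close> after cutting
  it into pieces of length \<open>1 / blind_scale \<sigma> (k + 1)\<close>.  The factor \<open>2 ^ i\<close> makes the sum of all
  later changes negligible even compared with the length of the current pieces.
\<close>

definition blind_scale :: "(nat \<Rightarrow> real) \<Rightarrow> nat \<Rightarrow> nat" where
  "blind_scale \<sigma> k = (\<Prod>i<k. 2 ^ i * (1 + nat \<lceil>\<bar>\<sigma> (Suc i) - \<sigma> i\<bar>\<rceil>))"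

definition blind_term :: "(nat \<Rightarrow> real) \<Rightarrow> nat \<Rightarrow> real \<Rightarrow> real" where
  "blind_term \<sigma> k m =
     (\<sigma> (Suc k) - \<sigma> k) * frac (real (blind_scale \<sigma> (Suc k)) * m) / real (blind_scale \<sigma> (Suc k))"

definition blind :: "(nat \<Rightarrow> real) \<Rightarrow> real \<Rightarrow> real" where
  "blind \<sigma> m = (\<Sum>k. blind_term \<sigma> k m)"

lemma blind_scale_pos: "0 < blind_scale \<sigma> k"
  by (simp add: blind_scale_def)

text \<open>Divisibility means that the cuts of a later stage refine all earlier cuts.\<close>

lemma blind_scale_dvd: "j \<le> k \<Longrightarrow> blind_scale \<sigma> j dvd blind_scale \<sigma> k"
  unfolding blind_scale_def by (rule prod_dvd_prod_subset) auto

lemma blind_scale_mono: "j \<le> k \<Longrightarrow> blind_scale \<sigma> j \<le> blind_scale \<sigma> k"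
  using blind_scale_dvd blind_scale_pos dvd_imp_le by blast

text \<open>The new scale is the old one times \<open>2 ^ k\<close> times a factor that is at least
  the change of slope. This factor absorbs the change, and \<open>2 ^ k\<close> leaves the geometric
  decay.\<close>

lemma abs_blind_term_le: "\<bar>blind_term \<sigma> k m\<bar> \<le> (1 / 2) ^ k / real (blind_scale \<sigma> k)"
proof -
  define d where "d = \<bar>\<sigma> (Suc k) - \<sigma> k\<bar>"
  define N where "N = real (blind_scale \<sigma> k)"
  define M where "M = real (1 + nat \<lceil>d\<rceil>)"
  have N: "0 < N" using blind_scale_pos by (simp add: N_def)
  have M: "0 < M" "d \<le> M" unfolding M_def by linarith+
  have scale: "real (blind_scale \<sigma> (Suc k)) = N * (2 ^ k * M)"
    unfolding blind_scale_def N_def M_def d_def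
    by (simp only: prod.lessThan_Suc of_nat_mult of_nat_power of_nat_numeral)
  have "\<bar>blind_term \<sigma> k m\<bar> = d * frac (N * (2 ^ k * M) * m) / (N * (2 ^ k * M))"
    using N M unfolding blind_term_def scale
    by (simp add: abs_mult d_def)
  also have "\<dots> \<le> M * 1 / (N * (2 ^ k * M))"
    using N M frac_lt_1[of "N * (2 ^ k * M) * m"]
    by (intro divide_right_mono mult_mono) (auto simp: less_imp_le)
  also have "\<dots> = (1 / 2) ^ k / N"
    using N M by (simp add: field_simps power_divide)
  finally show ?thesis by (simp add: N_def)
qed

lemma summable_blind_term: "summable (\<lambda>k. blind_term \<sigma> k m)"
proof (rule summable_comparison_test')
  show "summable (\<lambda>k. (1 / 2 :: real) ^ k)" by (rule summable_geometric) simp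
  fix k
  have "(1 / 2) ^ k / real (blind_scale \<sigma> k) \<le> (1 / 2 :: real) ^ k / 1"
    using blind_scale_pos[of \<sigma> k] by (intro divide_left_mono) auto
  then show "norm (blind_term \<sigma> k m) \<le> (1 / 2) ^ k"
    using abs_blind_term_le[of \<sigma> k m] by simp
qed

text \<open>A geometric tail in which every later scale is at least
  \<open>blind_scale \<sigma> n\<close>. That scale is kept in the denominator so that the error is
  small relative to the length of a current piece, and hence still small when summed over all
  pieces.\<close>

lemma abs_blind_minus_partial_sum_le:
  "\<bar>blind \<sigma> m - (\<Sum>k<n. blind_term \<sigma> k m)\<bar> \<le> 2 * (1 / 2) ^ n / real (blind_scale \<sigma> n)"
proof -
  let ?N = "real (blind_scale \<sigma> n)"
  have "blind \<sigma> m - (\<Sum>k<n. blind_term \<sigma> k m) = (\<Sum>k. blind_term \<sigma> (k + n) m)"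
    unfolding blind_def
    using suminf_split_initial_segment[OF summable_blind_term, of \<sigma> m n] by simp
  moreover have "norm (\<Sum>k. blind_term \<sigma> (k + n) m) \<le> (\<Sum>k. (1 / 2) ^ k * ((1 / 2) ^ n / ?N))"
  proof (rule norm_suminf_le)
    show "summable (\<lambda>k. (1 / 2) ^ k * ((1 / 2) ^ n / ?N))"
      by (intro summable_mult2 summable_geometric) simp
    fix k
    have "(1 / 2) ^ (k + n) / real (blind_scale \<sigma> (k + n)) \<le> (1 / 2) ^ (k + n) / ?N"
      using blind_scale_pos[of \<sigma>] blind_scale_mono[of n "k + n" \<sigma>]
      by (intro divide_left_mono) auto
    then show "norm (blind_term \<sigma> (k + n) m) \<le> (1 / 2) ^ k * ((1 / 2) ^ n / ?N)"
      using abs_blind_term_le[of \<sigma> "k + n" m] by (simp add: power_add)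
  qed
  moreover have "(\<Sum>k. (1 / 2) ^ k * ((1 / 2) ^ n / ?N)) = 2 * (1 / 2) ^ n / ?N"
    by (subst suminf_mult2[symmetric]) (auto intro: summable_geometric simp: suminf_geometric)
  ultimately show ?thesis by simp
qed

lemma abs_blind_le: "\<bar>blind \<sigma> m\<bar> \<le> 2"
  using abs_blind_minus_partial_sum_le[of \<sigma> m 0] by (simp add: blind_scale_def)

text \<open>Where the floor of \<open>blind_scale \<sigma> n * m\<close> is constant, every earlier
  fractional part is affine in \<open>m\<close>, because its scale divides the current one. The
  slopes telescope, and the intercept depends only on the index of the piece.\<close>

lemma blind_partial_sum:
  obtains g :: "int \<Rightarrow> real" where
    "\<And>m. (\<Sum>k<n. blind_term \<sigma> k m) = (\<sigma> n - \<sigma> 0) * m + g \<lfloor>real (blind_scale \<sigma> n) * m\<rfloor>"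
proof -
  let ?N = "blind_scale \<sigma>"
  \<comment> \<open>The intercept of term \<open>k\<close> on piece \<open>i\<close>; the integer
    division recovers the index of the coarser piece containing piece \<open>i\<close>.\<close>
  define h where "h k i = - ((\<sigma> (Suc k) - \<sigma> k) *
      (real_of_int (i div int (?N n div ?N (Suc k))) / real (?N (Suc k))))" for k i
  have "blind_term \<sigma> k m = (\<sigma> (Suc k) - \<sigma> k) * m + h k \<lfloor>real (?N n) * m\<rfloor>" if "k < n" for k m
  proof -
    have pos: "0 < ?N (Suc k)" "0 < ?N n" by (rule blind_scale_pos)+
    have "?N (Suc k) dvd ?N n" using that by (intro blind_scale_dvd) simp
    then obtain c where c: "?N n = ?N (Suc k) * c" by (rule dvdE)
    have "0 < ?N (Suc k) * c" using pos(2) unfolding c .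
    then have "0 < c" by simp
    have "real (?N (Suc k)) * m = real (?N n) * m / real_of_int (int c)"
      using \<open>0 < c\<close> by (simp add: c)
    then have fl: "\<lfloor>real (?N (Suc k)) * m\<rfloor> = \<lfloor>real (?N n) * m\<rfloor> div int c"
      using floor_divide_real_eq_div[of "int c"] by simp
    have c_eq: "int (?N n div ?N (Suc k)) = int c" using c pos by simp
    have "frac (real (?N (Suc k)) * m) / real (?N (Suc k)) =
        m - real_of_int (\<lfloor>real (?N n) * m\<rfloor> div int c) / real (?N (Suc k))"
      using pos by (simp add: frac_def fl diff_divide_distrib)
    then have "blind_term \<sigma> k m = (\<sigma> (Suc k) - \<sigma> k) *
        (m - real_of_int (\<lfloor>real (?N n) * m\<rfloor> div int c) / real (?N (Suc k)))"
      unfolding blind_term_def by (metis times_divide_eq_right)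
    then show ?thesis
      unfolding h_def c_eq by (simp only: right_diff_distrib diff_conv_add_uminus[of "_ * m"])
  qed
  then have "(\<Sum>k<n. blind_term \<sigma> k m) =
      (\<Sum>k<n. \<sigma> (Suc k) - \<sigma> k) * m + (\<Sum>k<n. h k \<lfloor>real (?N n) * m\<rfloor>)" for m
    by (simp add: sum.distrib sum_distrib_right)
  then show thesis
    using that[of "\<lambda>i. \<Sum>k<n. h k i"] by (simp add: sum_lessThan_telescope)
qed

section \<open>Null projections of the closed blind graph\<close>

text \<open>
  Each of the at most \<open>3 N\<close> pieces of stage \<open>n\<close> (with \<open>N = blind_scale \<sigma> n\<close>) projects into
  an interval of length \<open>2 r\<close>.
\<close>

lemma blind_projection_cover:
  assumes "\<bar>\<sigma> n - \<sigma> 0 + w\<bar> \<le> e" and "0 \<le> e"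
  obtains U where "closed U" "emeasure lborel U \<le> ennreal (6 * (e + 2 * (1 / 2) ^ n))"
    "\<And>m. \<bar>m\<bar> \<le> 1 \<Longrightarrow> blind \<sigma> m + m * w \<in> U"
proof -
  obtain g where g: "\<And>m. (\<Sum>k<n. blind_term \<sigma> k m) =
      (\<sigma> n - \<sigma> 0) * m + g \<lfloor>real (blind_scale \<sigma> n) * m\<rfloor>"
    using blind_partial_sum by blast
  define N where "N = blind_scale \<sigma> n"
  have N: "0 < N" unfolding N_def by (rule blind_scale_pos)
  define s where "s = \<sigma> n - \<sigma> 0 + w"
  define r where "r = (e + 2 * (1 / 2) ^ n) / real N"
  have r: "0 \<le> r" using assms N by (simp add: r_def)
  \<comment> \<open>The projected stage has slope \<open>s\<close> on piece \<open>i\<close>, and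
    \<open>z i\<close> is its value at the left end \<open>i / N\<close>.\<close>
  define z where "z i = g i + s * (real_of_int i / real N)" for i
  \<comment> \<open>Both ends occur, since \<open>m = 1\<close> has floor \<open>N\<close>. The
    \<open>2 * N + 1\<close> indices are at most \<open>3 * N\<close> because \<open>N\<close> is
    positive.\<close>
  define I where "I = {- int N .. int N}"
  define U where "U = (\<Union>i\<in>I. {z i - r .. z i + r})"
  have "closed U" unfolding U_def I_def by (intro closed_UN) auto
  moreover have "emeasure lborel U \<le> ennreal (6 * (e + 2 * (1 / 2) ^ n))"
  proof -
    have "emeasure lborel U \<le> (\<Sum>i\<in>I. emeasure lborel {z i - r .. z i + r})"
      unfolding U_def I_def by (intro emeasure_subadditive_finite) auto
    also have "\<dots> = (\<Sum>i\<in>I. ennreal (2 * r))" using r by simp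
    also have "\<dots> = ennreal (real (card I) * (2 * r))"
      using r by (simp add: ennreal_mult' ennreal_of_nat_eq_real_of_nat)
    also have "\<dots> \<le> ennreal (real (3 * N) * (2 * r))"
      using N r by (intro ennreal_leI mult_right_mono) (auto simp: I_def)
    also have "real (3 * N) * (2 * r) = 6 * (e + 2 * (1 / 2) ^ n)"
      using N by (simp add: r_def)
    finally show ?thesis .
  qed
  moreover have "blind \<sigma> m + m * w \<in> U" if m: "\<bar>m\<bar> \<le> 1" for m
  proof -
    define i where "i = \<lfloor>real N * m\<rfloor>"
    have "\<bar>real N * m\<bar> \<le> real N" using m N by (simp add: abs_mult mult_left_le)
    then have "i \<in> I" unfolding I_def i_def by (auto simp: le_floor_iff floor_le_iff)
    have frac: "\<bar>m - real_of_int i / real N\<bar> \<le> 1 / real N"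
    proof -
      have "m - real_of_int i / real N = frac (real N * m) / real N"
        using N by (simp add: i_def frac_def field_simps)
      then show ?thesis
        using N frac_ge_0[of "real N * m"] frac_lt_1[of "real N * m"]
        by (simp add: divide_right_mono less_imp_le)
    qed
    \<comment> \<open>The error splits into the tail of the series and the drift of the stage within
      one piece; the two bounds add up to \<open>r\<close>.\<close>
    have "blind \<sigma> m + m * w - z i =
        (blind \<sigma> m - (\<Sum>k<n. blind_term \<sigma> k m)) + s * (m - real_of_int i / real N)"
      unfolding g z_def s_def i_def N_def by (simp add: algebra_simps)
    also have "\<bar>\<dots>\<bar> \<le> 2 * (1 / 2) ^ n / real N + e * (1 / real N)"
    proof (intro order_trans[OF abs_triangle_ineq] add_mono)
      show "\<bar>blind \<sigma> m - (\<Sum>k<n. blind_term \<sigma> k m)\<bar> \<le> 2 * (1 / 2) ^ n / real N"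
        unfolding N_def by (rule abs_blind_minus_partial_sum_le)
      show "\<bar>s * (m - real_of_int i / real N)\<bar> \<le> e * (1 / real N)"
        unfolding abs_mult using assms frac by (intro mult_mono) (auto simp: s_def)
    qed
    also have "\<dots> = r" by (simp add: r_def add_divide_distrib)
    finally have "blind \<sigma> m + m * w \<in> {z i - r .. z i + r}" by (auto simp: abs_le_iff)
    with \<open>i \<in> I\<close> show ?thesis unfolding U_def by blast
  qed
  ultimately show thesis using that by blast
qed

text \<open>At stages with \<open>\<sigma> n\<close> close to \<open>\<sigma> 0 - w\<close> the
  projection almost cancels the slope, so the projected graph has closed covers of arbitrarily small
  measure.\<close>

lemma exists_compact_null_projections:
  obtains G :: "(real \<times> real) set" where "compact G"
    "\<And>m. \<bar>m\<bar> \<le> 1 \<Longrightarrow> \<exists>c. (m, c) \<in> G"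
    "\<And>w. (\<lambda>(m, c). c + m * w) ` G \<in> null_sets lborel"
proof -
  obtain \<sigma> :: "nat \<Rightarrow> real"
    where \<sigma>: "\<And>w e n. 0 < e \<Longrightarrow> \<exists>k\<ge>n. \<bar>\<sigma> k - w\<bar> < e"
    using exists_recurrent_dense_sequence by blast
  define \<Gamma> where "\<Gamma> = (\<lambda>m. (m, blind \<sigma> m)) ` {-1..1}"
  define G where "G = closure \<Gamma>"
  have "\<Gamma> \<subseteq> {-1..1} \<times> {-2..2}"
    using abs_le_D1[OF abs_blind_le[of \<sigma>]] abs_le_D2[OF abs_blind_le[of \<sigma>]]
    by (auto simp: \<Gamma>_def minus_le_iff[of "blind \<sigma> _" 2])
  then have "bounded \<Gamma>"
    by (rule bounded_subset[rotated]) (intro bounded_Times bounded_closed_interval)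
  then have "compact G" by (simp add: G_def)
  moreover have "\<exists>c. (m, c) \<in> G" if "\<bar>m\<bar> \<le> 1" for m
  proof -
    have "(m, blind \<sigma> m) \<in> \<Gamma>" using that by (auto simp: \<Gamma>_def abs_le_iff)
    then show ?thesis unfolding G_def using closure_subset[of \<Gamma>] by blast
  qed
  moreover have "(\<lambda>(m, c). c + m * w) ` G \<in> null_sets lborel" for w
  proof -
    let ?A = "(\<lambda>(m, c). c + m * w) ` G"
    have "compact ?A"
      using \<open>compact G\<close> by (intro compact_continuous_image)
        (auto simp: case_prod_unfold intro!: continuous_intros)
    then have "?A \<in> sets lborel" by (simp add: borel_compact)
    moreover have small: "emeasure lborel ?A \<le> ennreal \<delta>" if "0 < \<delta>" for \<delta>
    proof -
      \<comment> \<open>Both the slope error and \<open>(1 / 2) ^ n\<close> will be below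
        \<open>e\<close>, and 6 (e + 2 e) = 18 e.\<close>
      define e where "e = \<delta> / 18"
      have "0 < e" using that by (simp add: e_def)
      then obtain n0 where n0: "(1 / 2) ^ n0 < e"
        using real_arch_pow_inv[of e "1 / 2"] by auto
      obtain n where "n \<ge> n0" and n: "\<bar>\<sigma> n - (\<sigma> 0 - w)\<bar> < e" using \<sigma> \<open>0 < e\<close> by blast
      then have "(1 / 2) ^ n < e" by (intro le_less_trans[OF power_decreasing n0]) auto
      then have le: "6 * (e + 2 * (1 / 2) ^ n) \<le> \<delta>" by (simp add: e_def)
      obtain U where U: "closed U" "emeasure lborel U \<le> ennreal (6 * (e + 2 * (1 / 2) ^ n))"
        "\<And>m. \<bar>m\<bar> \<le> 1 \<Longrightarrow> blind \<sigma> m + m * w \<in> U"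
        using blind_projection_cover[of \<sigma> n w e] n \<open>0 < e\<close> by (auto simp: algebra_simps)
      \<comment> \<open>As \<open>U\<close> is closed, its preimage contains the closure
        \<open>G\<close> as soon as it contains the graph \<open>\<Gamma>\<close>.\<close>
      have "G \<subseteq> (\<lambda>p. snd p + fst p * w) -` U"
        unfolding G_def
      proof (rule closure_minimal)
        show "\<Gamma> \<subseteq> (\<lambda>p. snd p + fst p * w) -` U"
          using U(3) by (auto simp: \<Gamma>_def abs_le_iff)
        show "closed ((\<lambda>p. snd p + fst p * w) -` U)"
          using U(1) by (intro closed_vimage) (auto intro!: continuous_intros)
      qed
      then have "?A \<subseteq> U" by auto
      then have "emeasure lborel ?A \<le> emeasure lborel U"
        using U(1) by (intro emeasure_mono) auto
      with U(2) le show ?thesis by (meson ennreal_leI order_trans)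
    qed
    have "emeasure lborel ?A \<le> 0"
      by (rule ennreal_le_epsilon) (simp add: small)
    ultimately show ?thesis by (simp add: null_sets_def)
  qed
  ultimately show thesis using that by blast
qed


section \<open>Closed null sets containing lines of the complex\<close>

text \<open>Fubini twice: over (y, t) for fixed x, then over x. Closedness supplies the
  measurability at both stages.\<close>

lemma closed_null_if_null_vertical_sections:
  fixes K :: "R3 set"
  assumes "closed K" and "\<And>x y. AE t in lborel. (x, y, t) \<notin> K"
  shows "K \<in> null_sets lborel"
proof -
  have inner: "pair_sigma_finite (lborel :: real measure) (lborel :: real measure)" ..
  have outer: "pair_sigma_finite (lborel :: real measure) (lborel :: (real \<times> real) measure)" ..
  have meas: "K \<in> sets borel" using assms(1) by (rule borel_closed)
  have "AE q in lborel. (x, q) \<notin> K" for x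
  proof -
    have "closed (Pair x -` K)"
      using assms(1) by (intro closed_vimage) (auto intro!: continuous_intros)
    then have "- (Pair x -` K) \<in> sets borel" by (intro borel_open open_Compl)
    also have "- (Pair x -` K) = {q. (x, q) \<notin> K}" by auto
    finally have "{q. (x, q) \<notin> K} \<in> sets borel" .
    then have "{q \<in> space (lborel \<Otimes>\<^sub>M lborel). (x, q) \<notin> K} \<in> sets (lborel \<Otimes>\<^sub>M lborel)"
      unfolding lborel_prod by simp
    then have "AE q in lborel \<Otimes>\<^sub>M lborel. (x, q) \<notin> K"
      using assms(2) by (intro pair_sigma_finite.AE_pair_measure[OF inner]) auto
    then show ?thesis unfolding lborel_prod .
  qed
  moreover have "{p \<in> space (lborel \<Otimes>\<^sub>M lborel). p \<notin> K} \<in> sets (lborel \<Otimes>\<^sub>M lborel)"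
    unfolding lborel_prod using borel_open[OF open_Compl[OF assms(1)]]
    by (simp add: Compl_eq)
  ultimately have "AE p in lborel \<Otimes>\<^sub>M lborel. p \<notin> K"
    by (intro pair_sigma_finite.AE_pair_measure[OF outer]) auto
  then have "AE p in lborel. p \<notin> K" unfolding lborel_prod .
  then show ?thesis using meas by (simp add: AE_iff_null_sets)
qed

text \<open>For nonzero \<kappa>, a union of hyperbolic paraboloids. Whole surfaces are taken rather
  than chosen lines, because the surface with parameters (m, c) contains, over the horizontal slope
  m, a line of the complex of every vertical slope.\<close>

definition quadric_union :: "real \<Rightarrow> (real \<times> real) set \<Rightarrow> R3 set" where
  "quadric_union \<kappa> G = {(x, y, t). \<exists>m c. (m, c) \<in> G \<and> \<kappa> * t + x * y = c + m * x\<^sup>2}"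

text \<open>The incidence relation \<open>T\<close> is closed, and projecting it along the compact
  parameter set keeps it closed.\<close>

lemma closed_quadric_union:
  assumes "compact G"
  shows "closed (quadric_union \<kappa> G)"
proof -
  define T where "T = {(q, p). \<kappa> * snd (snd p) + fst p * fst (snd p) = snd q + fst q * (fst p)\<^sup>2}"
  have "T = {z. \<kappa> * snd (snd (snd z)) + fst (snd z) * fst (snd (snd z)) =
                snd (fst z) + fst (fst z) * (fst (snd z))\<^sup>2}"
    by (auto simp: T_def)
  also have "closed \<dots>" by (intro closed_Collect_eq continuous_intros)
  finally have "closed {p. \<exists>q. q \<in> G \<and> (q, p) \<in> T}"
    using assms by (rule closed_compact_projection[rotated])
  also have "{p. \<exists>q. q \<in> G \<and> (q, p) \<in> T} = quadric_union \<kappa> G"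
    by (fastforce simp: T_def quadric_union_def)
  finally show ?thesis .
qed

text \<open>Over a fixed (x, y), the invertible affine map t |-> x y + \<kappa> t sends the vertical
  section into the projection of \<open>G\<close> with parameter x^2.\<close>

lemma AE_not_in_quadric_union:
  assumes "(\<lambda>(m, c). c + m * x\<^sup>2) ` G \<in> null_sets lborel" and "\<kappa> \<noteq> 0"
  shows "AE t in lborel. (x, y, t) \<notin> quadric_union \<kappa> G"
proof -
  let ?A = "(\<lambda>(m, c). c + m * x\<^sup>2) ` G"
  have "?A \<in> sets borel" using assms(1) by (auto simp: null_sets_def)
  then have "Measurable.pred borel (\<lambda>s. s \<notin> ?A)" by measurable
  then have "AE t in lborel. x * y + \<kappa> * t \<notin> ?A"
    using assms AE_borel_affine[of \<kappa> "\<lambda>s. s \<notin> ?A" "x * y"] AE_not_in by blast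
  then show ?thesis
    by (rule AE_mp) (rule AE_I2, force simp: quadric_union_def algebra_simps)
qed

text \<open>One surface union covers horizontal slopes in [-1, 1] and its mirror image the others.
  The bound on the base point is recorded because it stays finite away from the poles, which later
  gives compactness.\<close>

lemma exists_closed_null_set_of_complex_lines:
  assumes "\<kappa> > 0"
  obtains K B where "closed K" "K \<in> null_sets lebesgue"
    "\<And>v1 v2 v3. (v1, v2) \<noteq> (0, 0) \<Longrightarrow>
       \<exists>p1 p2 p3. p1 * v2 - p2 * v1 = \<kappa> * v3 \<and>
         norm (p1, p2, p3) \<le> B + 2 * \<kappa> * \<bar>v3\<bar> / norm (v1, v2) \<and>
         range (\<lambda>r. (p1, p2, p3) + r *\<^sub>R (v1, v2, v3)) \<subseteq> K"
proof -
  obtain G :: "(real \<times> real) set" where G: "compact G"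
    "\<And>m. \<bar>m\<bar> \<le> 1 \<Longrightarrow> \<exists>c. (m, c) \<in> G"
    "\<And>w. (\<lambda>(m, c). c + m * w) ` G \<in> null_sets lborel"
    using exists_compact_null_projections by blast
  obtain C where C: "\<And>q. q \<in> G \<Longrightarrow> norm q \<le> C"
    using compact_imp_bounded[OF G(1)] by (auto simp: bounded_iff)
  define Q where "Q = quadric_union \<kappa> G"
  \<comment> \<open>This involution negates both sides of the moment condition, so it preserves the
    complex, and it inverts horizontal slopes.\<close>
  define \<phi> :: "R3 \<Rightarrow> R3" where "\<phi> = (\<lambda>(x, y, t). (y, x, - t))"
  have "closed Q" unfolding Q_def by (rule closed_quadric_union) fact
  moreover have "closed (\<phi> -` Q)"
    using \<open>closed Q\<close> unfolding \<phi>_def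
    by (intro closed_vimage) (auto simp: case_prod_unfold intro!: continuous_intros)
  ultimately have clo: "closed (Q \<union> \<phi> -` Q)" by (rule closed_Un)
  have Q_ae: "AE t in lborel. (x, y, t) \<notin> Q" for x y
    unfolding Q_def using assms G(3) by (intro AE_not_in_quadric_union) auto
  have "AE t in lborel. (x, y, t) \<notin> Q \<union> \<phi> -` Q" for x y
  proof -
    have "closed ((\<lambda>t. (y, x, t)) -` Q)"
      using \<open>closed Q\<close> by (intro closed_vimage) (auto intro!: continuous_intros)
    then have "(\<lambda>t. (y, x, t)) -` Q \<in> sets borel" by (rule borel_closed)
    then have "Measurable.pred borel (\<lambda>t. t \<notin> (\<lambda>t. (y, x, t)) -` Q)" by measurable
    then have "Measurable.pred borel (\<lambda>t. (y, x, t) \<notin> Q)" by simp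
    from AE_borel_affine[OF _ this Q_ae, of "-1" 0]
    have "AE t in lborel. (y, x, - t) \<notin> Q" by simp
    with Q_ae[of x y] show ?thesis by eventually_elim (simp add: \<phi>_def)
  qed
  then have "Q \<union> \<phi> -` Q \<in> null_sets lborel"
    by (intro closed_null_if_null_vertical_sections clo)
  then have null: "Q \<union> \<phi> -` Q \<in> null_sets lebesgue"
    by (simp add: null_sets_completionI)
  show thesis
  proof (rule that[OF clo null])
    fix v1 v2 v3 :: real
    assume v: "(v1, v2) \<noteq> (0, 0)"
    have norm_v: "0 < norm (v1, v2)" "norm (v1, v2) \<le> \<bar>v1\<bar> + \<bar>v2\<bar>"
      using v norm_Pair_le[of v1 v2] by (auto simp: zero_prod_def)
    \<comment> \<open>Here \<open>u\<close> is the larger of \<bar>v1\<bar> and \<bar>v2\<bar>,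
      hence at least half of the horizontal norm.\<close>
    have bound: "norm (p1, p2, p3) \<le> C / \<kappa> + 2 * \<kappa> * \<bar>v3\<bar> / norm (v1, v2)"
      if "(p1 = 0 \<and> \<bar>p2\<bar> = \<kappa> * \<bar>v3\<bar> / u) \<or> (p2 = 0 \<and> \<bar>p1\<bar> = \<kappa> * \<bar>v3\<bar> / u)" "\<bar>p3\<bar> = \<bar>c\<bar> / \<kappa>"
        "(m, c) \<in> G" "norm (v1, v2) \<le> 2 * u" for p1 p2 p3 u m c
    proof -
      have "norm (p1, p2, p3) \<le> \<bar>p1\<bar> + (\<bar>p2\<bar> + \<bar>p3\<bar>)"
        using norm_Pair_le[of p1 "(p2, p3)"] norm_Pair_le[of p2 p3] by simp
      also have "\<bar>p1\<bar> + (\<bar>p2\<bar> + \<bar>p3\<bar>) = \<kappa> * \<bar>v3\<bar> / u + \<bar>c\<bar> / \<kappa>" using that by auto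
      also have "\<bar>c\<bar> / \<kappa> \<le> C / \<kappa>"
        using C[OF that(3)] norm_snd_le[of c m] assms by (intro divide_right_mono) auto
      also have "\<kappa> * \<bar>v3\<bar> / u \<le> \<kappa> * \<bar>v3\<bar> / (norm (v1, v2) / 2)"
        using that(4) norm_v(1) assms by (intro frac_le) auto
      finally show ?thesis by (simp add: mult_ac)
    qed
    show "\<exists>p1 p2 p3. p1 * v2 - p2 * v1 = \<kappa> * v3 \<and>
         norm (p1, p2, p3) \<le> C / \<kappa> + 2 * \<kappa> * \<bar>v3\<bar> / norm (v1, v2) \<and>
         range (\<lambda>r. (p1, p2, p3) + r *\<^sub>R (v1, v2, v3)) \<subseteq> Q \<union> \<phi> -` Q"
    proof (cases "\<bar>v2\<bar> \<le> \<bar>v1\<bar>")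
      case True
      then have "v1 \<noteq> 0" using v by auto
      have "\<bar>v2 / v1\<bar> \<le> 1" using True \<open>v1 \<noteq> 0\<close> by (simp add: abs_divide)
      then obtain c where c: "(v2 / v1, c) \<in> G" using G(2) by blast
      show ?thesis
      proof (intro exI conjI)
        \<comment> \<open>The base point is taken on x = 0, where the moment condition forces its
          second coordinate and the equation of the surface its third.\<close>
        show "0 * v2 - (- \<kappa> * v3 / v1) * v1 = \<kappa> * v3" using \<open>v1 \<noteq> 0\<close> by simp
        show "norm (0 :: real, - \<kappa> * v3 / v1, c / \<kappa>) \<le> C / \<kappa> + 2 * \<kappa> * \<bar>v3\<bar> / norm (v1, v2)"
          using True norm_v assms c
          by (intro bound[of _ _ "\<bar>v1\<bar>"]) (auto simp: abs_mult abs_divide)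
        show "range (\<lambda>r. (0, - \<kappa> * v3 / v1, c / \<kappa>) + r *\<^sub>R (v1, v2, v3)) \<subseteq> Q \<union> \<phi> -` Q"
        proof (intro image_subsetI UnI1)
          fix r
          \<comment> \<open>The second coordinate of the base point makes the terms linear in
            \<open>r\<close> cancel.\<close>
          have "\<kappa> * (c / \<kappa> + r * v3) + (r * v1) * (- \<kappa> * v3 / v1 + r * v2) =
              c + v2 / v1 * (r * v1)\<^sup>2"
            using \<open>v1 \<noteq> 0\<close> assms by (simp add: field_simps power2_eq_square)
          with c show "(0, - \<kappa> * v3 / v1, c / \<kappa>) + r *\<^sub>R (v1, v2, v3) \<in> Q"
            unfolding Q_def quadric_union_def add_Pair scaleR_Pair real_scaleR_def mem_Collect_eq
              prod.case add_0
            by blast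
        qed
      qed
    next
      case False
      then have "v2 \<noteq> 0" by auto
      have "\<bar>v1 / v2\<bar> \<le> 1" using False \<open>v2 \<noteq> 0\<close> by (simp add: abs_divide)
      \<comment> \<open>After \<open>\<phi>\<close> the horizontal slope is \<open>v1 / v2\<close>,
        and the base point is now taken on y = 0.\<close>
      then obtain c where c: "(v1 / v2, c) \<in> G" using G(2) by blast
      show ?thesis
      proof (intro exI conjI)
        show "(\<kappa> * v3 / v2) * v2 - 0 * v1 = \<kappa> * v3" using \<open>v2 \<noteq> 0\<close> by simp
        show "norm (\<kappa> * v3 / v2, 0 :: real, - c / \<kappa>) \<le> C / \<kappa> + 2 * \<kappa> * \<bar>v3\<bar> / norm (v1, v2)"
          using False norm_v assms c
          by (intro bound[of _ _ "\<bar>v2\<bar>"]) (auto simp: abs_mult abs_divide)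
        show "range (\<lambda>r. (\<kappa> * v3 / v2, 0, - c / \<kappa>) + r *\<^sub>R (v1, v2, v3)) \<subseteq> Q \<union> \<phi> -` Q"
        proof (intro image_subsetI UnI2)
          fix r
          have "\<kappa> * - (- c / \<kappa> + r * v3) + (r * v2) * (\<kappa> * v3 / v2 + r * v1) =
              c + v1 / v2 * (r * v2)\<^sup>2"
            using \<open>v2 \<noteq> 0\<close> assms by (simp add: field_simps power2_eq_square)
          with c show "(\<kappa> * v3 / v2, 0, - c / \<kappa>) + r *\<^sub>R (v1, v2, v3) \<in> \<phi> -` Q"
            unfolding Q_def \<phi>_def quadric_union_def add_Pair scaleR_Pair real_scaleR_def
              vimage_eq mem_Collect_eq prod.case add_0
            by blast
        qed
      qed
    qed
  qed
qed

section \<open>Recognising horizontal and SL2 lines by their moment\<close>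

text \<open>Left translation by p tilts the direction of angle \<theta> to vertical slope (p1 sin
  \<theta> - p2 cos \<theta>) / 2, which is what the moment condition prescribes.\<close>

lemma horizontal_line_if_moment:
  assumes "(v1, v2) \<noteq> (0, 0)" and "p1 * v2 - p2 * v1 = 2 * v3"
  shows "horizontal_line (range (\<lambda>r. (p1, p2, p3) + r *\<^sub>R (v1, v2, v3)))"
proof -
  obtain \<theta> \<rho> where \<theta>: "\<theta> \<in> {0..<pi}" "\<rho> \<noteq> 0" "v1 = \<rho> * cos \<theta>" "v2 = \<rho> * sin \<theta>"
  proof -
    \<comment> \<open>The sign makes the sine nonnegative, so the angle falls in [0, pi].\<close>
    define \<rho> where "\<rho> = (if v2 < 0 then - 1 else 1) * norm (v1, v2)"
    have "\<rho> \<noteq> 0" using assms(1) by (auto simp: \<rho>_def zero_prod_def)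
    have sq: "\<rho>\<^sup>2 = v1\<^sup>2 + v2\<^sup>2" by (simp add: \<rho>_def norm_Pair power_mult_distrib)
    have "0 \<le> v2 / \<rho>" by (auto simp: \<rho>_def zero_le_divide_iff)
    moreover have "(v1 / \<rho>)\<^sup>2 + (v2 / \<rho>)\<^sup>2 = 1"
      unfolding power_divide add_divide_distrib[symmetric] sq[symmetric]
      using \<open>\<rho> \<noteq> 0\<close> by simp
    ultimately obtain t where t: "0 \<le> t" "t \<le> pi" "v1 / \<rho> = cos t" "v2 / \<rho> = sin t"
      using sincos_total_pi by metis
    then have v: "v1 = \<rho> * cos t" "v2 = \<rho> * sin t" using \<open>\<rho> \<noteq> 0\<close> by (auto simp: field_simps)
    show thesis
    \<comment> \<open>The half-open range excludes pi; the angle 0 with \<open>- \<rho>\<close>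
      gives the same vector.\<close>
    proof (cases "t = pi")
      case True
      then show thesis using that[of 0 "- \<rho>"] v \<open>\<rho> \<noteq> 0\<close> by auto
    next
      case False
      then show thesis using that[of t \<rho>] v t \<open>\<rho> \<noteq> 0\<close> by auto
    qed
  qed
  have v3: "v3 = \<rho> * ((p1 * sin \<theta> - p2 * cos \<theta>) / 2)"
    using assms(2) \<theta> by (simp add: algebra_simps)
  have pt: "(p1, p2, p3) + r *\<^sub>R (v1, v2, v3) =
      (p1, p2, p3) \<star> ((r * \<rho>) * cos \<theta>, (r * \<rho>) * sin \<theta>, 0)" for r
    unfolding v3 \<theta>(3,4) by (simp add: field_simps)
  have "range (\<lambda>r. (p1, p2, p3) + r *\<^sub>R (v1, v2, v3)) = (\<lambda>q. (p1, p2, p3) \<star> q) ` V \<theta>"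
  proof (intro subset_antisym subsetI)
    fix z assume "z \<in> range (\<lambda>r. (p1, p2, p3) + r *\<^sub>R (v1, v2, v3))"
    then show "z \<in> (\<lambda>q. (p1, p2, p3) \<star> q) ` V \<theta>" unfolding pt V_def by blast
  next
    fix z assume "z \<in> (\<lambda>q. (p1, p2, p3) \<star> q) ` V \<theta>"
    then obtain s where "z = (p1, p2, p3) \<star> (s * cos \<theta>, s * sin \<theta>, 0)"
      unfolding V_def by blast
    then have "z = (p1, p2, p3) + (s / \<rho>) *\<^sub>R (v1, v2, v3)"
      using pt[of "s / \<rho>"] \<theta>(2) by simp
    then show "z \<in> range (\<lambda>r. (p1, p2, p3) + r *\<^sub>R (v1, v2, v3))" by blast
  qed
  then show ?thesis unfolding horizontal_line_def using \<theta>(1) by blast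
qed

text \<open>Moves the base point along a line and rescales its direction, to reach the normal forms
  in \<open>SL2_line\<close>.\<close>

lemma range_line_reparametrize:
  fixes p v :: "'a :: real_vector"
  assumes "k \<noteq> 0"
  shows "range (\<lambda>r. (p + s *\<^sub>R v) + r *\<^sub>R v) = {p + r *\<^sub>R (k *\<^sub>R v) | r. r \<in> UNIV}"
proof (intro subset_antisym subsetI)
  fix z assume "z \<in> range (\<lambda>r. (p + s *\<^sub>R v) + r *\<^sub>R v)"
  then obtain r where "z = (p + s *\<^sub>R v) + r *\<^sub>R v" by blast
  then have "z = p + ((s + r) / k) *\<^sub>R (k *\<^sub>R v)"
    using assms by (simp add: scaleR_add_left)
  then show "z \<in> {p + r *\<^sub>R (k *\<^sub>R v) | r. r \<in> UNIV}" by blast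
next
  fix z assume "z \<in> {p + r *\<^sub>R (k *\<^sub>R v) | r. r \<in> UNIV}"
  then obtain r where "z = p + r *\<^sub>R (k *\<^sub>R v)" by blast
  then have "z = (p + s *\<^sub>R v) + (r * k - s) *\<^sub>R v"
    by (simp add: scaleR_diff_left)
  then show "z \<in> range (\<lambda>r. (p + s *\<^sub>R v) + r *\<^sub>R v)" by blast
qed

text \<open>If v3 = 0, the horizontal part of the base point is parallel to the direction, so the
  line meets the t-axis. Otherwise the line is rebased at t = 0 and its direction scaled to last
  coordinate 1, which turns the moment condition into the determinant condition.\<close>

lemma SL2_line_if_moment:
  assumes "(v1, v2) \<noteq> (0, 0)" and "p1 * v2 - p2 * v1 = v3"
  shows "SL2_line (range (\<lambda>r. (p1, p2, p3) + r *\<^sub>R (v1, v2, v3)))"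
proof (cases "v3 = 0")
  case True
  \<comment> \<open>The coefficient of the orthogonal projection of (p1, p2) onto (v1, v2).\<close>
  define s where "s = (p1 * v1 + p2 * v2) / (v1\<^sup>2 + v2\<^sup>2)"
  have nz: "v1\<^sup>2 + v2\<^sup>2 \<noteq> 0" using assms(1) by (simp add: sum_power2_eq_zero_iff)
  have cross: "p1 * v2 = p2 * v1" using assms(2) True by simp
  have "p1 * (v1\<^sup>2 + v2\<^sup>2) = (p1 * v1 + p2 * v2) * v1"
    using cross by (simp add: algebra_simps power2_eq_square)
  moreover have "p2 * (v1\<^sup>2 + v2\<^sup>2) = (p1 * v1 + p2 * v2) * v2"
    using cross by (simp add: algebra_simps power2_eq_square)
  ultimately have "(p1, p2, p3) = (0, 0, p3) + s *\<^sub>R (v1, v2, v3)"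
    using nz True by (simp add: s_def eq_divide_eq)
  then have "range (\<lambda>r. (p1, p2, p3) + r *\<^sub>R (v1, v2, v3)) =
      {(0, 0, p3) + r *\<^sub>R (v1, v2, 0) | r. r \<in> UNIV}"
    using range_line_reparametrize[of 1 "(0, 0, p3)" s "(v1, v2, v3)"] True by simp
  then show ?thesis unfolding SL2_line_def using assms(1) by blast
next
  case False
  define c d where "c = v1 / v3" and "d = v2 / v3"
  have "(p1 - p3 * c) * d - (p2 - p3 * d) * c = (p1 * v2 - p2 * v1) / v3"
    by (simp add: c_def d_def algebra_simps diff_divide_distrib)
  then have "(p1 - p3 * c) * d - (p2 - p3 * d) * c = 1" using assms(2) False by simp
  moreover have "(p1, p2, p3) = (p1 - p3 * c, p2 - p3 * d, 0) + (p3 / v3) *\<^sub>R (v1, v2, v3)"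
    using False by (simp add: c_def d_def)
  then have "range (\<lambda>r. (p1, p2, p3) + r *\<^sub>R (v1, v2, v3)) =
      {(p1 - p3 * c, p2 - p3 * d, 0) + r *\<^sub>R (c, d, 1) | r. r \<in> UNIV}"
    using range_line_reparametrize[of "1 / v3" "(p1 - p3 * c, p2 - p3 * d, 0)" "p3 / v3" "(v1, v2, v3)"]
      False by (simp add: c_def d_def)
  ultimately show ?thesis unfolding SL2_line_def by blast
qed

section \<open>Directions, unit segments and distance from the poles\<close>

lemma has_direction_subset_line:
  assumes "S \<subseteq> range (\<lambda>r. p + r *\<^sub>R v)" and "v \<noteq> 0"
  shows "has_direction S v"
  unfolding has_direction_def
proof (intro conjI ballI assms(2))
  fix x y assume "x \<in> S" "y \<in> S"
  then obtain r s where "x = p + r *\<^sub>R v" "y = p + s *\<^sub>R v" using assms(1) by blast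
  then have "y - x = (s - r) *\<^sub>R v" by (simp add: scaleR_diff_left)
  then show "y - x \<in> span {v}" by (simp add: span_base span_scale)
qed

lemma closed_segment_subset_line:
  fixes p v :: "'a :: real_vector"
  shows "closed_segment p (p + v) \<subseteq> range (\<lambda>r. p + r *\<^sub>R v)"
proof
  fix x assume "x \<in> closed_segment p (p + v)"
  then obtain u where "x = (1 - u) *\<^sub>R p + u *\<^sub>R (p + v)" unfolding closed_segment_def by blast
  then have "x = p + u *\<^sub>R v" by (simp add: algebra_simps)
  then show "x \<in> range (\<lambda>r. p + r *\<^sub>R v)" by blast
qed

lemma unit_segment_of_closed_segment:
  assumes "norm v = 1" and "is_special (range (\<lambda>r. p + r *\<^sub>R v))"
  shows "unit_segment_of is_special (closed_segment p (p + v))"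
  unfolding unit_segment_of_def
proof (intro conjI exI)
  show "closed_segment p (p + v) = closed_segment p (p + v)" ..
  show "dist p (p + v) = 1" using assms(1) by (simp add: dist_norm)
  show "is_special (range (\<lambda>r. p + r *\<^sub>R v))" by fact
  show "closed_segment p (p + v) \<subseteq> range (\<lambda>r. p + r *\<^sub>R v)" by (rule closed_segment_subset_line)
qed

lemma horizontal_part_nonzero:
  assumes "(v1, v2, v3) \<in> sphere 0 1 - poles"
  shows "(v1, v2) \<noteq> (0, 0)"
proof
  assume "(v1, v2) = (0, 0)"
  then have "\<bar>v3\<bar> = 1" using assms by (simp add: norm_Pair)
  then show False using assms \<open>(v1, v2) = (0, 0)\<close> by (auto simp: poles_def abs_if split: if_splits)
qed

text \<open>With r the horizontal norm, the nearer pole is at distance at most r + (1 -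
  \<bar>v3\<bar>), and 1 - \<bar>v3\<bar> \<le> 1 - v3^2 = r^2 \<le> r.\<close>

lemma horizontal_part_lower_bound:
  assumes "(v1, v2, v3) \<in> sphere 0 1 - nbhd \<epsilon> poles"
  shows "\<epsilon> \<le> 2 * norm (v1, v2)"
proof -
  define r where "r = norm (v1, v2)"
  define s :: real where "s = (if v3 < 0 then - 1 else 1)"
  have r2: "r\<^sup>2 = v1\<^sup>2 + v2\<^sup>2" and "0 \<le> r" by (simp_all add: r_def norm_Pair)
  have "v1\<^sup>2 + (v2\<^sup>2 + v3\<^sup>2) = 1" using assms by (simp add: norm_Pair)
  then have one: "r\<^sup>2 + \<bar>v3\<bar>\<^sup>2 = 1" using r2 by simp
  then have "\<bar>v3\<bar>\<^sup>2 \<le> 1" "r\<^sup>2 \<le> 1" by (smt (verit) zero_le_power2)+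
  then have le1: "\<bar>v3\<bar> \<le> 1" "r \<le> 1" using \<open>0 \<le> r\<close> by (auto simp: power_le_one_iff abs_square_le_1)
  have "(0, 0, s) \<in> poles" by (simp add: s_def poles_def)
  then have "\<epsilon> \<le> dist (0, 0, s) (v1, v2, v3)"
    using assms unfolding nbhd_def by fastforce
  also have "\<dots> = norm ((v1, v2, 0) + (0, 0, v3 - s))"
    by (subst dist_commute) (simp add: dist_norm)
  also have "\<dots> \<le> norm (v1, v2, 0 :: real) + norm (0 :: real, 0 :: real, v3 - s)"
    by (rule norm_triangle_ineq)
  also have "\<dots> = r + \<bar>v3 - s\<bar>" by (simp add: r_def norm_Pair)
  also have "\<bar>v3 - s\<bar> = 1 - \<bar>v3\<bar>" using le1 by (auto simp: s_def)
  also have "1 - \<bar>v3\<bar> \<le> 1 - \<bar>v3\<bar>\<^sup>2"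
    using le1 power_decreasing[of 1 2 "\<bar>v3\<bar>"] by simp
  also have "1 - \<bar>v3\<bar>\<^sup>2 = r\<^sup>2" using one by simp
  also have "r\<^sup>2 \<le> r" using le1 \<open>0 \<le> r\<close> power_decreasing[of 1 2 r] by simp
  finally show ?thesis by (simp add: r_def)
qed

section \<open>Kakeya sets for both families\<close>

text \<open>One closed null set serves for lines and for segments, each segment starting at the base
  point of its line. Away from the poles the base points are bounded, so intersecting with a ball
  gives a compact set.\<close>

lemma kakeya_sets_for_line_complex:
  assumes "\<kappa> > 0"
    and special: "\<And>p1 p2 p3 v1 v2 v3. (v1, v2) \<noteq> (0, 0) \<Longrightarrow> p1 * v2 - p2 * v1 = \<kappa> * v3 \<Longrightarrow>
      is_special (range (\<lambda>r. (p1, p2, p3) + r *\<^sub>R (v1, v2, v3)))"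
  shows "\<forall>\<epsilon>>0. \<exists>K :: R3 set. compact K \<and> K \<in> null_sets lebesgue \<and>
        (\<forall>v \<in> sphere 0 1 - nbhd \<epsilon> poles.
           \<exists>S\<subseteq>K. unit_segment_of is_special S \<and> has_direction S v)" (is ?compact)
    and "\<exists>K :: R3 set. closed K \<and> K \<in> null_sets lebesgue \<and>
        (\<forall>v \<in> sphere 0 1 - poles.
           \<exists>S\<subseteq>K. unit_segment_of is_special S \<and> has_direction S v)" (is ?closed)
    and "\<exists>K :: R3 set. closed K \<and> K \<in> null_sets lebesgue \<and>
        (\<forall>v \<in> sphere 0 1 - poles. \<exists>l\<subseteq>K. is_special l \<and> has_direction l v)" (is ?lines)
proof -
  obtain K B where K: "closed K" "K \<in> null_sets lebesgue"
    and B: "\<And>v1 v2 v3. (v1, v2) \<noteq> (0, 0) \<Longrightarrow>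
       \<exists>p1 p2 p3. p1 * v2 - p2 * v1 = \<kappa> * v3 \<and>
         norm (p1, p2, p3) \<le> B + 2 * \<kappa> * \<bar>v3\<bar> / norm (v1, v2) \<and>
         range (\<lambda>r. (p1, p2, p3) + r *\<^sub>R (v1, v2, v3)) \<subseteq> K"
    using exists_closed_null_set_of_complex_lines[OF assms(1)] by metis
  have line: "\<exists>p. is_special (range (\<lambda>r. p + r *\<^sub>R v)) \<and> range (\<lambda>r. p + r *\<^sub>R v) \<subseteq> K \<and>
      norm p \<le> B + 2 * \<kappa> * \<bar>snd (snd v)\<bar> / norm (fst v, fst (snd v))"
    if "v \<in> sphere 0 1 - poles" for v
  proof -
    obtain v1 v2 v3 where v: "v = (v1, v2, v3)" by (cases v)
    then have nz: "(v1, v2) \<noteq> (0, 0)" using that horizontal_part_nonzero by blast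
    then show ?thesis using B[OF nz, of v3] special[OF nz] unfolding v by fastforce
  qed
  have segment: "unit_segment_of is_special (closed_segment p (p + v)) \<and>
      has_direction (closed_segment p (p + v)) v"
    if "norm v = 1" "is_special (range (\<lambda>r. p + r *\<^sub>R v))" for p v
  proof
    show "unit_segment_of is_special (closed_segment p (p + v))"
      using that by (rule unit_segment_of_closed_segment)
    have "v \<noteq> 0" using that(1) by auto
    then show "has_direction (closed_segment p (p + v)) v"
      by (rule has_direction_subset_line[OF closed_segment_subset_line])
  qed
  show ?lines
  proof (rule exI[of _ K], intro conjI K ballI)
    fix v assume v: "v \<in> sphere 0 1 - poles"
    then have "v \<noteq> 0" by auto
    then show "\<exists>l\<subseteq>K. is_special l \<and> has_direction l v"
      using line[OF v] has_direction_subset_line[OF subset_refl] by metis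
  qed
  show ?closed
  proof (rule exI[of _ K], intro conjI K ballI)
    fix v assume v: "v \<in> sphere 0 1 - poles"
    then have "norm v = 1" by auto
    obtain p where p: "is_special (range (\<lambda>r. p + r *\<^sub>R v))" "range (\<lambda>r. p + r *\<^sub>R v) \<subseteq> K"
      using line[OF v] by blast
    then show "\<exists>S\<subseteq>K. unit_segment_of is_special S \<and> has_direction S v"
      using segment[OF \<open>norm v = 1\<close> p(1)] closed_segment_subset_line[of p v] by blast
  qed
  show ?compact
  proof (intro allI impI)
    fix \<epsilon> :: real assume "0 < \<epsilon>"
    \<comment> \<open>The horizontal norm is at least \<epsilon> / 2 and \<bar>v3\<bar> \<le> 1,
      which gives the middle term; the final 1 is the length of the segment.\<close>
    define R where "R = B + 4 * \<kappa> / \<epsilon> + 1"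
    have "compact (K \<inter> cball 0 R)" using K(1) by (intro closed_Int_compact) auto
    moreover have "K \<inter> cball 0 R \<in> null_sets lebesgue"
      using K(2) by (rule null_set_Int2) auto
    moreover have "\<exists>S\<subseteq>K \<inter> cball 0 R. unit_segment_of is_special S \<and> has_direction S v"
      if v: "v \<in> sphere 0 1 - nbhd \<epsilon> poles" for v
    proof -
      have "norm v = 1" using v by auto
      have "v \<in> sphere 0 1 - poles"
        using v \<open>0 < \<epsilon>\<close> by (auto simp: nbhd_def)
      then obtain p where p: "is_special (range (\<lambda>r. p + r *\<^sub>R v))"
        "range (\<lambda>r. p + r *\<^sub>R v) \<subseteq> K"
        "norm p \<le> B + 2 * \<kappa> * \<bar>snd (snd v)\<bar> / norm (fst v, fst (snd v))"
        using line by blast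
      have "\<epsilon> \<le> 2 * norm (fst v, fst (snd v))"
        using horizontal_part_lower_bound[of "fst v" "fst (snd v)" "snd (snd v)" \<epsilon>] v by simp
      moreover have "\<bar>snd (snd v)\<bar> \<le> 1"
        using norm_snd_le[of "snd v" "fst v"] norm_snd_le[of "snd (snd v)" "fst (snd v)"] \<open>norm v = 1\<close>
        by simp
      ultimately have "2 * \<kappa> * \<bar>snd (snd v)\<bar> / norm (fst v, fst (snd v)) \<le> 2 * \<kappa> * 1 / (\<epsilon> / 2)"
        using \<open>0 < \<epsilon>\<close> assms(1) by (intro frac_le mult_left_mono) auto
      then have "norm p \<le> R - 1" using p(3) by (simp add: R_def)
      moreover have "norm (p + v) \<le> norm p + 1" using norm_triangle_ineq[of p v] \<open>norm v = 1\<close> by simp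
      ultimately have "p \<in> cball 0 R" "p + v \<in> cball 0 R" by auto
      then have "closed_segment p (p + v) \<subseteq> cball 0 R"
        by (intro closed_segment_subset convex_cball)
      moreover have "closed_segment p (p + v) \<subseteq> K"
        using closed_segment_subset_line p(2) by (rule subset_trans)
      ultimately have "closed_segment p (p + v) \<subseteq> K \<inter> cball 0 R" by simp
      with segment[OF \<open>norm v = 1\<close> p(1)] show ?thesis by metis
    qed
    ultimately show "\<exists>K :: R3 set. compact K \<and> K \<in> null_sets lebesgue \<and>
        (\<forall>v \<in> sphere 0 1 - nbhd \<epsilon> poles.
           \<exists>S\<subseteq>K. unit_segment_of is_special S \<and> has_direction S v)" by metis
  qed
qed

theorem theorem2p2:
  "(\<forall>\<epsilon>>0. \<exists>K :: R3 set. compact K \<and> K \<in> null_sets lebesgue \<and>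
        (\<forall>v \<in> sphere 0 1 - nbhd \<epsilon> poles.
           \<exists>S\<subseteq>K. unit_segment_of horizontal_line S \<and> has_direction S v)) \<and>
   (\<exists>K :: R3 set. closed K \<and> K \<in> null_sets lebesgue \<and>
        (\<forall>v \<in> sphere 0 1 - poles.
           \<exists>S\<subseteq>K. unit_segment_of horizontal_line S \<and> has_direction S v)) \<and>
   (\<exists>K :: R3 set. closed K \<and> K \<in> null_sets lebesgue \<and>
        (\<forall>v \<in> sphere 0 1 - poles.
           \<exists>l\<subseteq>K. horizontal_line l \<and> has_direction l v)) \<and>
   (\<forall>\<epsilon>>0. \<exists>K :: R3 set. compact K \<and> K \<in> null_sets lebesgue \<and>
        (\<forall>v \<in> sphere 0 1 - nbhd \<epsilon> poles.
           \<exists>S\<subseteq>K. unit_segment_of SL2_line S \<and> has_direction S v)) \<and>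
   (\<exists>K :: R3 set. closed K \<and> K \<in> null_sets lebesgue \<and>
        (\<forall>v \<in> sphere 0 1 - poles.
           \<exists>S\<subseteq>K. unit_segment_of SL2_line S \<and> has_direction S v)) \<and>
   (\<exists>K :: R3 set. closed K \<and> K \<in> null_sets lebesgue \<and>
        (\<forall>v \<in> sphere 0 1 - poles.
           \<exists>l\<subseteq>K. SL2_line l \<and> has_direction l v))"
proof -
  \<comment> \<open>The value \<kappa> = 2 reflects the factor 1/2 in the Heisenberg product; for
    SL2 lines the determinant 1 gives \<kappa> = 1.\<close>
  note horizontal = kakeya_sets_for_line_complex[of 2 horizontal_line, OF _ horizontal_line_if_moment]
  have SL2: "SL2_line (range (\<lambda>r. (p1, p2, p3) + r *\<^sub>R (v1, v2, v3)))"
    if "(v1, v2) \<noteq> (0, 0)" "p1 * v2 - p2 * v1 = 1 * v3" for p1 p2 p3 v1 v2 v3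
    using SL2_line_if_moment that by simp
  note SL2 = kakeya_sets_for_line_complex[of 1 SL2_line, OF _ SL2]
  show ?thesis
    by (intro conjI horizontal SL2) simp_all
qed

end
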